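(* Let $G$ be a set and let $p$ be a primitive element of $(B,\mu,1,\Delta,\varepsilon)$, the free (nonassociative, unital) algebra generated by $G$ with its natural bialgebra structure. Let $\alpha$ be a linear endomorphism of the vector space $\mathbb{K}\langle G\rangle$ spanned by $G$. Then the Hom-type element $p^\alpha$ obtained from $p$ is a primitive element of the free unitary Hom-algebra generated by $(\mathbb{K}\langle G\rangle,\alpha)$ with its natural Hom-bialgebra structure $(\mathcal B,\mu,u,\Delta_\alpha,\epsilon,\alpha)$.
   Context: $\mathbb{K}$ is a field of characteristic zero. A Hom-algebra $(A,\mu,\alpha)$ (with one bilinear product $\mu$, written as juxtaposition, not assumed associative) is an algebra with an algebra endomorphism $\alpha$. It is unitary if there is a linear map $u:\mathbb{K}\to A$ with $\mu(u(1),x)=\mu(x,u(1))=\alpha(x)$ for all $x\in A$ and $\alpha\circ u=u$. On $A\otimes A$ the product is componentwise and the twisting map is $\alpha\otimes\alpha$. The natural bialgebra structure on the free unital nonassociative algebra $B$ on $G$: $\Delta:B\to B\otimes B$ and $\varepsilon:B\to\mathbb{K}$ are the unital algebra morphisms with $\Delta(g)=1\otimes g+g\otimes 1$, $\varepsilon(g)=0$ for $g\in G$. The free unitary Hom-algebra generated by $(\mathbb{K}\langle G\rangle,\alpha)$ is the free object of the category of unitary Hom-algebras on a vector space with endomorphism; its twisting map (again denoted $\alpha$) extends the given $\alpha$ on $\mathbb{K}\langle G\rangle$. Its natural Hom-bialgebra structure: $\Delta_\alpha$ and $\epsilon$ are the morphisms of Hom-algebras (to the tensor square, resp. to $(\mathbb{K},\mathrm{id})$)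 with $\Delta_\alpha(g)=u(1)\otimes g+g\otimes u(1)$, $\epsilon(g)=0$ for $g\in G$, and $\Delta_\alpha(u(1))=u(1)\otimes u(1)$, $\epsilon(u(1))=1$. An element $p$ is primitive if its coproduct is $1\otimes p+p\otimes 1$ (resp. $u(1)\otimes p+p\otimes u(1)$). The Hom-type element $p^\alpha$: write $p=\sum_i\lambda_i m_i$ with $m_i$ nonassociative words in $G$, each $m_i$ being a planar binary tree whose leaves are labelled by elements of $G$. For each tree and each internal node $N$ of it, apply $\alpha$ to every leaf that is not a descendant of $N$ (powers of $\alpha$ accumulating over the nodes); evaluating the resulting trees in the free unitary Hom-algebra and taking the same linear combination gives $p^\alpha$. For example $(xy)z-x(yz)$ gives $(xy)\alpha(z)-\alpha(x)(yz)$. *)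

theory Defs
  imports "HOL-Library.Poly_Mapping" "HOL-Library.Sublist" "HOL.Vector_Spaces"
begin

section \<open>Vector spaces with a basis\<close>

text \<open>The vector space over \<open>'k\<close> with basis the type \<open>'x\<close> is the type \<open>'x \<Rightarrow>\<^sub>0 'k\<close> of
  finitely supported functions; in particular \<open>'g \<Rightarrow>\<^sub>0 'k\<close> is the space spanned by a set \<open>'g\<close>
  of generators.\<close>

definition smult :: "'k::field \<Rightarrow> ('x \<Rightarrow>\<^sub>0 'k) \<Rightarrow> ('x \<Rightarrow>\<^sub>0 'k)" where
  "smult c p = Poly_Mapping.map ((*) c) p"

definition basis :: "'x \<Rightarrow> ('x \<Rightarrow>\<^sub>0 'k::field)" where
  "basis x = Poly_Mapping.single x 1"

definition lin_ext :: "('k::field \<Rightarrow> 'c::ab_group_add \<Rightarrow> 'c) \<Rightarrow> ('x \<Rightarrow> 'c) \<Rightarrow> ('x \<Rightarrow>\<^sub>0 'k) \<Rightarrow> 'c" where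
  "lin_ext s f p = (\<Sum>x\<in>Poly_Mapping.keys p. s (Poly_Mapping.lookup p x) (f x))"

definition bilin_ext ::
  "('k::field \<Rightarrow> 'c::ab_group_add \<Rightarrow> 'c) \<Rightarrow> ('x \<Rightarrow> 'y \<Rightarrow> 'c) \<Rightarrow> ('x \<Rightarrow>\<^sub>0 'k) \<Rightarrow> ('y \<Rightarrow>\<^sub>0 'k) \<Rightarrow> 'c" where
  "bilin_ext s f p q = lin_ext s (\<lambda>x. lin_ext s (f x) q) p"

definition bilinear_map ::
  "('k::field \<Rightarrow> 'a::ab_group_add \<Rightarrow> 'a) \<Rightarrow> ('k \<Rightarrow> 'b::ab_group_add \<Rightarrow> 'b) \<Rightarrow>
   ('k \<Rightarrow> 'c::ab_group_add \<Rightarrow> 'c) \<Rightarrow> ('a \<Rightarrow> 'b \<Rightarrow> 'c) \<Rightarrow> bool" where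
  "bilinear_map s1 s2 s3 h \<longleftrightarrow>
     (\<forall>x. Vector_Spaces.linear s2 s3 (h x)) \<and> (\<forall>y. Vector_Spaces.linear s1 s3 (\<lambda>x. h x y))"

lemma lookup_smult [simp]: "Poly_Mapping.lookup (smult c p) x = c * Poly_Mapping.lookup p x"
  by (simp add: smult_def Poly_Mapping.map.rep_eq when_def)

lemma vector_space_smult: "vector_space smult"
  by standard (auto intro!: poly_mapping_eqI simp: lookup_add algebra_simps)

lemma vector_space_field: "vector_space ((*) :: 'k::field \<Rightarrow> 'k \<Rightarrow> 'k)"
  by standard (auto simp: algebra_simps)

lemma linearI:
  assumes "vector_space s1" "vector_space s2"
    "\<And>x y. f (x + y) = f x + f y" "\<And>c x. f (s1 c x) = s2 c (f x)"
  shows "Vector_Spaces.linear s1 s2 f"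
  using assms by (simp add: Vector_Spaces.linear_def module_hom_def module_hom_axioms_def
      module_iff_vector_space)

lemma linearD:
  assumes "Vector_Spaces.linear s1 s2 f"
  shows "vector_space s1" "vector_space s2"
    "f (x + y) = f x + f y" "f (s1 c x) = s2 c (f x)" "f 0 = 0"
    "f (sum g A) = (\<Sum>i\<in>A. f (g i))"
proof -
  interpret Vector_Spaces.linear s1 s2 f by fact
  show "vector_space s1" "vector_space s2" by unfold_locales
  show "f (x + y) = f x + f y" "f (s1 c x) = s2 c (f x)" "f 0 = 0"
    "f (sum g A) = (\<Sum>i\<in>A. f (g i))"
    by (simp_all add: add scale sum)
qed

lemma lin_comp:
  assumes f: "Vector_Spaces.linear s1 s2 f" and g: "Vector_Spaces.linear s2 s3 g"
  shows "Vector_Spaces.linear s1 s3 (\<lambda>x. g (f x))"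
  by (rule linearI) (simp_all add: linearD[OF f] linearD[OF g])

lemma lin_add:
  assumes f: "Vector_Spaces.linear s1 s2 f" and g: "Vector_Spaces.linear s1 s2 g"
  shows "Vector_Spaces.linear s1 s2 (\<lambda>x. f x + g x)"
proof -
  interpret vector_space s2 using f by (rule linearD)
  show ?thesis
    by (rule linearI)
      (simp_all add: linearD[OF f] linearD[OF g] scale_right_distrib add.assoc add.left_commute)
qed

lemma lin_zero:
  assumes "vector_space s1" "vector_space s2"
  shows "Vector_Spaces.linear s1 s2 (\<lambda>x. 0)"
proof -
  interpret vector_space s2 by fact
  show ?thesis by (rule linearI) (use assms in simp_all)
qed

lemma lin_ident: "vector_space s \<Longrightarrow> Vector_Spaces.linear s s (\<lambda>x. x)"
  by (rule linearI) simp_all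

lemma lin_scale_left: "vector_space s \<Longrightarrow> Vector_Spaces.linear (*) s (\<lambda>c. s c x)"
proof -
  assume v: "vector_space s"
  interpret vector_space s by fact
  show ?thesis by (rule linearI) (use v in \<open>simp_all add: vector_space_field scale_left_distrib\<close>)
qed

lemma bilinear_mapD:
  assumes "bilinear_map s1 s2 s3 h"
  shows "Vector_Spaces.linear s2 s3 (h x)" "Vector_Spaces.linear s1 s3 (\<lambda>x. h x y)"
  using assms by (simp_all add: bilinear_map_def)

lemma lin_ext_superset:
  assumes "vector_space s" "finite A" "Poly_Mapping.keys p \<subseteq> A"
  shows "lin_ext s f p = (\<Sum>x\<in>A. s (Poly_Mapping.lookup p x) (f x))"
proof -
  interpret vector_space s by fact
  show ?thesis unfolding lin_ext_def
    by (rule sum.mono_neutral_left) (use assms in \<open>auto simp: in_keys_iff\<close>)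
qed

lemma linear_lin_ext:
  assumes "vector_space s"
  shows "Vector_Spaces.linear smult s (lin_ext s f)"
proof (rule linearI)
  interpret vector_space s by fact
  fix p q :: "'c \<Rightarrow>\<^sub>0 'a" and c
  let ?A = "Poly_Mapping.keys p \<union> Poly_Mapping.keys q"
  have "Poly_Mapping.keys (p + q) \<subseteq> ?A" by (rule Poly_Mapping.keys_add)
  then show "lin_ext s f (p + q) = lin_ext s f p + lin_ext s f q"
    by (simp add: lin_ext_superset[OF assms, where A = ?A] lookup_add scale_left_distrib sum.distrib)
  have "Poly_Mapping.keys (smult c p) \<subseteq> Poly_Mapping.keys p" by (auto simp: in_keys_iff)
  then show "lin_ext s f (smult c p) = s c (lin_ext s f p)"
    by (simp add: lin_ext_superset[OF assms, where A = "Poly_Mapping.keys p"] scale_sum_right)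
qed (use assms vector_space_smult in auto)

lemma lin_ext_basis [simp]:
  assumes "vector_space s"
  shows "lin_ext s f (basis x) = f x"
proof -
  interpret vector_space s by fact
  show ?thesis by (simp add: lin_ext_def basis_def)
qed

lemma expand_basis: "p = (\<Sum>x\<in>Poly_Mapping.keys p. smult (Poly_Mapping.lookup p x) (basis x))"
  by (rule poly_mapping_eqI)
    (auto simp: lookup_sum basis_def lookup_single when_def in_keys_iff if_distrib[of "\<lambda>z. _ * z"]
      cong: if_cong)

lemma linear_eq_on_keys:
  assumes f: "Vector_Spaces.linear smult s f" and g: "Vector_Spaces.linear smult s g"
    and eq: "\<And>x. x \<in> Poly_Mapping.keys p \<Longrightarrow> f (basis x) = g (basis x)"
  shows "f p = g p"
proof -
  have "f p = (\<Sum>x\<in>Poly_Mapping.keys p. s (Poly_Mapping.lookup p x) (f (basis x)))"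
    by (subst expand_basis[of p]) (simp add: linearD[OF f])
  also have "\<dots> = (\<Sum>x\<in>Poly_Mapping.keys p. s (Poly_Mapping.lookup p x) (g (basis x)))"
    by (simp add: eq)
  also have "\<dots> = g p"
    by (subst (3) expand_basis[of p]) (simp add: linearD[OF g])
  finally show ?thesis .
qed

lemma linear_eqI:
  assumes "Vector_Spaces.linear smult s f" "Vector_Spaces.linear smult s g"
    and "\<And>x. f (basis x) = g (basis x)"
  shows "f = g"
  by (rule ext) (rule linear_eq_on_keys[OF assms(1,2)], rule assms(3))

lemma bilinear_eq_on_keys:
  assumes f: "bilinear_map smult smult s f" and g: "bilinear_map smult smult s g"
    and eq: "\<And>x y. x \<in> Poly_Mapping.keys p \<Longrightarrow> y \<in> Poly_Mapping.keys q \<Longrightarrow>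
      f (basis x) (basis y) = g (basis x) (basis y)"
  shows "f p q = g p q"
proof (rule linear_eq_on_keys[OF bilinear_mapD(2)[OF f] bilinear_mapD(2)[OF g]])
  fix x assume "x \<in> Poly_Mapping.keys p"
  then show "f (basis x) q = g (basis x) q"
    by (rule linear_eq_on_keys[OF bilinear_mapD(1)[OF f] bilinear_mapD(1)[OF g] eq])
qed

lemma bilinear_bilin_ext:
  assumes "vector_space s"
  shows "bilinear_map smult smult s (bilin_ext s f)"
proof -
  interpret vector_space s by fact
  have "Vector_Spaces.linear smult s (bilin_ext s f p)" for p
    unfolding bilin_ext_def
    by (rule linearI)
      (simp_all add: assms vector_space_smult linearD[OF linear_lin_ext[OF assms]]
        lin_ext_def[of s _ p] scale_right_distrib sum.distrib scale_sum_right mult.commute)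
  moreover have "Vector_Spaces.linear smult s (\<lambda>p. bilin_ext s f p q)" for q
    unfolding bilin_ext_def by (rule linear_lin_ext[OF assms])
  ultimately show ?thesis by (simp add: bilinear_map_def)
qed

lemma bilin_ext_basis [simp]:
  "vector_space s \<Longrightarrow> bilin_ext s f (basis x) (basis y) = f x y"
  by (simp add: bilin_ext_def)

lemma bilinear_comp_out:
  "bilinear_map s1 s2 s3 h \<Longrightarrow> Vector_Spaces.linear s3 s4 g \<Longrightarrow>
   bilinear_map s1 s2 s4 (\<lambda>x y. g (h x y))"
  by (auto simp: bilinear_map_def intro: lin_comp)

lemma bilinear_comp_in:
  assumes h: "bilinear_map s3 s4 s5 h"
    and f: "Vector_Spaces.linear s1 s3 f" and g: "Vector_Spaces.linear s2 s4 g"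
  shows "bilinear_map s1 s2 s5 (\<lambda>x y. h (f x) (g y))"
  using lin_comp[OF g bilinear_mapD(1)[OF h]] lin_comp[OF f bilinear_mapD(2)[OF h]]
  by (simp add: bilinear_map_def)

lemma bilinear_field: "bilinear_map (*) (*) (*) ((*) :: 'k::field \<Rightarrow> 'k \<Rightarrow> 'k)"
  unfolding bilinear_map_def
  by (auto intro!: linearI simp: vector_space_field algebra_simps)


section \<open>Unital algebras and unitary Hom-algebras\<close>

text \<open>The unit is given as the linear map \<open>u\<close> from the ground field.\<close>

locale unital_algebra = vector_space s
  for s :: "'k::field \<Rightarrow> 'a::ab_group_add \<Rightarrow> 'a" +
  fixes m :: "'a \<Rightarrow> 'a \<Rightarrow> 'a" and u :: "'k \<Rightarrow> 'a"
  assumes m_bilinear: "bilinear_map s s s m"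
    and u_linear: "Vector_Spaces.linear (*) s u"
    and m_unit_left: "m (u 1) x = x"
    and m_unit_right: "m x (u 1) = x"

locale hom_algebra = vector_space s
  for s :: "'k::field \<Rightarrow> 'a::ab_group_add \<Rightarrow> 'a" +
  fixes m :: "'a \<Rightarrow> 'a \<Rightarrow> 'a" and a :: "'a \<Rightarrow> 'a"
  assumes m_bilinear: "bilinear_map s s s m"
    and a_linear: "Vector_Spaces.linear s s a"
    and a_mult: "a (m x y) = m (a x) (a y)"

locale unitary_hom_algebra = hom_algebra s m a
  for s :: "'k::field \<Rightarrow> 'a::ab_group_add \<Rightarrow> 'a" and m :: "'a \<Rightarrow> 'a \<Rightarrow> 'a"
    and a :: "'a \<Rightarrow> 'a" +
  fixes u :: "'k \<Rightarrow> 'a"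
  assumes u_linear: "Vector_Spaces.linear (*) s u"
    and m_unit_left: "m (u 1) x = a x"
    and m_unit_right: "m x (u 1) = a x"
    and a_unit: "a \<circ> u = u"

definition unital_algebra_hom where
  "unital_algebra_hom s1 m1 u1 s2 m2 u2 \<phi> \<longleftrightarrow>
     Vector_Spaces.linear s1 s2 \<phi> \<and> (\<forall>x y. \<phi> (m1 x y) = m2 (\<phi> x) (\<phi> y)) \<and> \<phi> \<circ> u1 = u2"

definition unitary_hom_algebra_hom where
  "unitary_hom_algebra_hom s1 m1 a1 u1 s2 m2 a2 u2 \<phi> \<longleftrightarrow>
     Vector_Spaces.linear s1 s2 \<phi> \<and> (\<forall>x y. \<phi> (m1 x y) = m2 (\<phi> x) (\<phi> y)) \<and>
     \<phi> \<circ> a1 = a2 \<circ> \<phi> \<and> \<phi> \<circ> u1 = u2"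


section \<open>The free unital nonassociative algebra\<close>

datatype 'g tree = Leaf 'g | Node "'g tree" "'g tree"

text \<open>Nonassociative words are planar binary trees with labelled leaves, together with the empty
  word \<open>None\<close>, which is the unit of the free algebra.\<close>

type_synonym 'g word = "'g tree option"

type_synonym ('g, 'k) free_alg = "'g word \<Rightarrow>\<^sub>0 'k"

fun word_mult :: "'g word \<Rightarrow> 'g word \<Rightarrow> 'g word" where
  "word_mult None y = y"
| "word_mult x None = x"
| "word_mult (Some l) (Some r) = Some (Node l r)"

definition mult :: "('g, 'k::field) free_alg \<Rightarrow> ('g, 'k) free_alg \<Rightarrow> ('g, 'k) free_alg" where
  "mult = bilin_ext smult (\<lambda>x y. basis (word_mult x y))"

definition unit :: "'k::field \<Rightarrow> ('g, 'k) free_alg" where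
  "unit c = Poly_Mapping.single None c"

definition gen :: "('g \<Rightarrow>\<^sub>0 'k::field) \<Rightarrow> ('g, 'k) free_alg" where
  "gen = lin_ext smult (\<lambda>g. basis (Some (Leaf g)))"

primrec eval_tree :: "('a \<Rightarrow> 'a \<Rightarrow> 'a) \<Rightarrow> 'a tree \<Rightarrow> 'a" where
  "eval_tree m (Leaf a) = a"
| "eval_tree m (Node l r) = m (eval_tree m l) (eval_tree m r)"

text \<open>The morphism induced by a linear map \<open>f\<close> on the span of the generators. It serves both for
  the free unital algebra and for the free unitary Hom-algebra, see \<open>free_unital_algebra\<close> and
  \<open>free_unitary_hom_algebra\<close> below.\<close>

definition induced ::
  "('k::field \<Rightarrow> 'c::ab_group_add \<Rightarrow> 'c) \<Rightarrow> ('c \<Rightarrow> 'c \<Rightarrow> 'c) \<Rightarrow> ('k \<Rightarrow> 'c) \<Rightarrow>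
   (('g \<Rightarrow>\<^sub>0 'k) \<Rightarrow> 'c) \<Rightarrow> ('g, 'k) free_alg \<Rightarrow> 'c" where
  "induced s m u f = lin_ext s (\<lambda>w. case w of
      None \<Rightarrow> u 1
    | Some t \<Rightarrow> eval_tree m (map_tree (\<lambda>g. f (basis g)) t))"

lemma mult_bilinear: "bilinear_map smult smult smult mult"
  unfolding mult_def by (rule bilinear_bilin_ext[OF vector_space_smult])

lemma mult_basis [simp]: "mult (basis x) (basis y) = basis (word_mult x y)"
  by (simp add: mult_def vector_space_smult)

lemma unit_linear: "Vector_Spaces.linear (*) smult unit"
  by (rule linearI)
    (auto simp: unit_def vector_space_field vector_space_smult single_add lookup_single when_def
      intro!: poly_mapping_eqI)

lemma unit_1: "unit 1 = basis None"
  by (simp add: unit_def basis_def)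

lemma unit_eq: "unit c = smult c (unit 1)"
  using linearD(4)[OF unit_linear, of c 1] by simp

lemma gen_linear: "Vector_Spaces.linear smult smult gen"
  unfolding gen_def by (rule linear_lin_ext[OF vector_space_smult])

lemma gen_basis [simp]: "gen (basis g) = basis (Some (Leaf g))"
  by (simp add: gen_def vector_space_smult)

theorem unital_algebra_free_alg: "unital_algebra smult (mult :: ('g, 'k::field) free_alg \<Rightarrow> _) unit"
proof -
  have "mult (unit 1) x = x" for x :: "('g, 'k) free_alg"
    by (rule linear_eq_on_keys[OF bilinear_mapD(1)[OF mult_bilinear]
          lin_ident[OF vector_space_smult]]) (simp add: unit_1)
  moreover have "mult x (unit 1) = x" for x :: "('g, 'k) free_alg"
  proof (rule linear_eq_on_keys[OF bilinear_mapD(2)[OF mult_bilinear]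
        lin_ident[OF vector_space_smult]])
    fix w
    show "mult (basis w) (unit 1) = basis w" by (cases w) (simp_all add: unit_1)
  qed
  ultimately show ?thesis
    by (auto simp: unital_algebra_def unital_algebra_axioms_def vector_space_smult mult_bilinear
        unit_linear)
qed

lemma induced_linear: "vector_space s \<Longrightarrow> Vector_Spaces.linear smult s (induced s m u f)"
  unfolding induced_def by (rule linear_lin_ext)

lemma induced_basis:
  assumes "vector_space s"
  shows "induced s m u f (basis None) = u 1"
    "induced s m u f (basis (Some (Leaf g))) = f (basis g)"
    "induced s m u f (basis (Some (Node l r))) =
      m (induced s m u f (basis (Some l))) (induced s m u f (basis (Some r)))"
  by (simp_all add: induced_def assms)

lemma induced_unit:
  assumes "Vector_Spaces.linear (*) s u"
  shows "induced s m u f (unit c) = u c"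
proof -
  have s: "vector_space s" using assms by (rule linearD)
  have "induced s m u f (unit c) = s c (u 1)"
    by (subst unit_eq) (simp add: linearD(4)[OF induced_linear[OF s]] unit_1 induced_basis s)
  also have "\<dots> = u c" using linearD(4)[OF assms, of c 1] by simp
  finally show ?thesis .
qed

lemma induced_gen:
  assumes "Vector_Spaces.linear smult s f"
  shows "induced s m u f (gen v) = f v"
proof -
  have s: "vector_space s" using assms by (rule linearD)
  show ?thesis
    by (rule linear_eq_on_keys[OF lin_comp[OF gen_linear induced_linear[OF s]] assms])
      (simp add: induced_basis s)
qed

lemma free_alg_hom_unique:
  assumes "Vector_Spaces.linear smult s \<phi>" "Vector_Spaces.linear smult s \<psi>"
    and unit: "\<phi> (unit 1) = \<psi> (unit 1)" and gen: "\<And>v. \<phi> (gen v) = \<psi> (gen v)"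
    and "\<And>l r. \<phi> (basis (Some (Node l r))) = m (\<phi> (basis (Some l))) (\<phi> (basis (Some r)))"
    and "\<And>l r. \<psi> (basis (Some (Node l r))) = m (\<psi> (basis (Some l))) (\<psi> (basis (Some r)))"
  shows "\<phi> = \<psi>"
proof (rule linear_eqI[OF assms(1,2)])
  have "\<phi> (basis (Some t)) = \<psi> (basis (Some t))" for t
  proof (induction t)
    case (Leaf g)
    then show ?case using gen[of "basis g"] by simp
  next
    case (Node l r)
    then show ?case by (simp add: assms)
  qed
  then show "\<phi> (basis w) = \<psi> (basis w)" for w
    using unit by (cases w) (simp_all add: unit_1)
qed

text \<open>The universal property; the target type is arbitrary.\<close>

theorem free_unital_algebra:
  assumes "unital_algebra s m u" and f: "Vector_Spaces.linear smult s f"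
  shows "unital_algebra_hom smult mult unit s m u (induced s m u f)"
    and "induced s m u f \<circ> gen = f"
    and "unital_algebra_hom smult mult unit s m u \<phi> \<Longrightarrow> \<phi> \<circ> gen = f \<Longrightarrow> \<phi> = induced s m u f"
proof -
  interpret unital_algebra s m u by fact
  have s: "vector_space s" by unfold_locales
  let ?\<phi> = "induced s m u f"
  note lin = induced_linear[OF s, of m u f]
  have "?\<phi> (mult x y) = m (?\<phi> x) (?\<phi> y)" for x y
  proof (rule bilinear_eq_on_keys[OF bilinear_comp_out[OF mult_bilinear lin]
        bilinear_comp_in[OF m_bilinear lin lin]])
    fix w v :: "'c word"
    show "?\<phi> (mult (basis w) (basis v)) = m (?\<phi> (basis w)) (?\<phi> (basis v))"
      by (cases w; cases v) (simp_all add: induced_basis s m_unit_left m_unit_right)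
  qed
  then show 1: "unital_algebra_hom smult mult unit s m u ?\<phi>"
    by (auto simp: unital_algebra_hom_def lin induced_unit[OF u_linear])
  show 2: "?\<phi> \<circ> gen = f" by (auto simp: induced_gen[OF f])
  show "\<phi> = ?\<phi>" if \<phi>: "unital_algebra_hom smult mult unit s m u \<phi>" "\<phi> \<circ> gen = f"
  proof (rule free_alg_hom_unique[where m = m and s = s])
    have node: "basis (Some (Node l r)) = mult (basis (Some l)) (basis (Some r))" for l r :: "'c tree"
      by simp
    show "\<phi> (basis (Some (Node l r))) = m (\<phi> (basis (Some l))) (\<phi> (basis (Some r)))" for l r
      using \<phi> unfolding node unital_algebra_hom_def by (simp del: mult_basis)
  qed (use \<phi> 1 2 lin in \<open>auto simp: unital_algebra_hom_def fun_eq_iff induced_basis s\<close>)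
qed


section \<open>The free unitary Hom-algebra\<close>

text \<open>In a unitary Hom-algebra multiplication by the unit is the twisting map, and the twisting map
  is moved down to the generators because it is multiplicative. So the free unitary Hom-algebra on
  the space spanned by \<open>'g\<close> with endomorphism \<open>\<alpha>\<close> has the same underlying vector space as the free
  unital algebra; only the products with the unit are different. This is justified by
  \<open>unitary_hom_algebra_free_alg\<close> and the universal property \<open>free_unitary_hom_algebra\<close>.\<close>

definition twist :: "(('g \<Rightarrow>\<^sub>0 'k) \<Rightarrow> ('g \<Rightarrow>\<^sub>0 'k)) \<Rightarrow> ('g, 'k::field) free_alg \<Rightarrow> ('g, 'k) free_alg"
  where "twist \<alpha> = induced smult mult unit (gen \<circ> \<alpha>)"

fun hom_word_mult ::
  "(('g \<Rightarrow>\<^sub>0 'k) \<Rightarrow> ('g \<Rightarrow>\<^sub>0 'k)) \<Rightarrow> 'g word \<Rightarrow> 'g word \<Rightarrow> ('g, 'k::field) free_alg" where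
  "hom_word_mult \<alpha> None y = twist \<alpha> (basis y)"
| "hom_word_mult \<alpha> x None = twist \<alpha> (basis x)"
| "hom_word_mult \<alpha> (Some l) (Some r) = basis (Some (Node l r))"

definition hom_mult ::
  "(('g \<Rightarrow>\<^sub>0 'k) \<Rightarrow> ('g \<Rightarrow>\<^sub>0 'k)) \<Rightarrow> ('g, 'k::field) free_alg \<Rightarrow> ('g, 'k) free_alg \<Rightarrow> ('g, 'k) free_alg"
  where "hom_mult \<alpha> = bilin_ext smult (hom_word_mult \<alpha>)"

lemma twist_linear: "Vector_Spaces.linear smult smult (twist \<alpha>)"
  unfolding twist_def by (rule induced_linear[OF vector_space_smult])

lemma hom_mult_bilinear: "bilinear_map smult smult smult (hom_mult \<alpha>)"
  unfolding hom_mult_def by (rule bilinear_bilin_ext[OF vector_space_smult])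

lemma hom_mult_basis [simp]: "hom_mult \<alpha> (basis x) (basis y) = hom_word_mult \<alpha> x y"
  by (simp add: hom_mult_def vector_space_smult)

lemma twist_basis [simp]:
  "twist \<alpha> (basis None) = basis None"
  "twist \<alpha> (basis (Some (Leaf g))) = gen (\<alpha> (basis g))"
  "twist \<alpha> (basis (Some (Node l r))) = mult (twist \<alpha> (basis (Some l))) (twist \<alpha> (basis (Some r)))"
  by (simp_all add: twist_def induced_basis vector_space_smult unit_1)

lemma twist_unit: "twist \<alpha> (unit c) = unit c"
  unfolding twist_def by (rule induced_unit[OF unit_linear])

lemma twist_gen:
  assumes "Vector_Spaces.linear smult smult \<alpha>"
  shows "twist \<alpha> (gen v) = gen (\<alpha> v)"
proof -
  have "Vector_Spaces.linear smult smult (gen \<circ> \<alpha>)"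
    using lin_comp[OF assms gen_linear] by (simp add: o_def)
  from induced_gen[OF this] show ?thesis by (simp add: twist_def)
qed

lemma lookup_None_linear: "Vector_Spaces.linear smult (*) (\<lambda>p. Poly_Mapping.lookup p None)"
  by (rule linearI) (simp_all add: vector_space_smult vector_space_field lookup_add)

lemma lookup_mult_None:
  "Poly_Mapping.lookup (mult p q) None = Poly_Mapping.lookup p None * Poly_Mapping.lookup q None"
proof (rule bilinear_eq_on_keys[OF bilinear_comp_out[OF mult_bilinear lookup_None_linear]
      bilinear_comp_in[OF bilinear_field lookup_None_linear lookup_None_linear]])
  fix x y
  show "Poly_Mapping.lookup (mult (basis x) (basis y)) None =
      Poly_Mapping.lookup (basis x) None * Poly_Mapping.lookup (basis y) None"
    by (cases x; cases y) (simp_all add: basis_def lookup_single when_def mult_basis[unfolded basis_def])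
qed

lemma lookup_gen_None: "Poly_Mapping.lookup (gen v) None = 0"
  by (rule linear_eq_on_keys[OF lin_comp[OF gen_linear lookup_None_linear]
        lin_zero[OF vector_space_smult vector_space_field]])
    (simp add: basis_def lookup_single gen_basis[unfolded basis_def])

lemma lookup_twist_None: "Poly_Mapping.lookup (twist \<alpha> (basis (Some t))) None = 0"
  by (induction t) (simp_all add: lookup_gen_None lookup_mult_None)

lemma hom_mult_eq_mult:
  assumes "Poly_Mapping.lookup p None = 0" "Poly_Mapping.lookup q None = 0"
  shows "hom_mult \<alpha> p q = mult p q"
proof (rule bilinear_eq_on_keys[OF hom_mult_bilinear mult_bilinear])
  fix x y assume "x \<in> Poly_Mapping.keys p" "y \<in> Poly_Mapping.keys q"
  then have "x \<noteq> None" "y \<noteq> None" using assms unfolding in_keys_iff by metis+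
  then show "hom_mult \<alpha> (basis x) (basis y) = mult (basis x) (basis y)" by auto
qed

lemma hom_mult_unit_left: "hom_mult \<alpha> (unit 1) x = twist \<alpha> x"
  by (rule linear_eq_on_keys[OF bilinear_mapD(1)[OF hom_mult_bilinear] twist_linear])
    (simp add: unit_1)

lemma hom_mult_unit_right: "hom_mult \<alpha> x (unit 1) = twist \<alpha> x"
proof (rule linear_eq_on_keys[OF bilinear_mapD(2)[OF hom_mult_bilinear] twist_linear])
  fix w
  show "hom_mult \<alpha> (basis w) (unit 1) = twist \<alpha> (basis w)" by (cases w) (simp_all add: unit_1)
qed

theorem unitary_hom_algebra_free_alg: "unitary_hom_algebra smult (hom_mult \<alpha>) (twist \<alpha>) unit"
proof -
  have "twist \<alpha> (hom_mult \<alpha> x y) = hom_mult \<alpha> (twist \<alpha> x) (twist \<alpha> y)" for x y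
  proof (rule bilinear_eq_on_keys[OF bilinear_comp_out[OF hom_mult_bilinear twist_linear]
        bilinear_comp_in[OF hom_mult_bilinear twist_linear twist_linear]])
    fix w v
    show "twist \<alpha> (hom_mult \<alpha> (basis w) (basis v)) =
        hom_mult \<alpha> (twist \<alpha> (basis w)) (twist \<alpha> (basis v))"
      by (cases w; cases v)
        (simp_all add: hom_mult_eq_mult lookup_twist_None
          hom_mult_unit_left[unfolded unit_1] hom_mult_unit_right[unfolded unit_1])
  qed
  then show ?thesis
    by (auto simp: unitary_hom_algebra_def unitary_hom_algebra_axioms_def hom_algebra_def
        hom_algebra_axioms_def vector_space_smult hom_mult_bilinear twist_linear unit_linear
        twist_unit hom_mult_unit_left hom_mult_unit_right)
qed

text \<open>The universal property; the target type is arbitrary.\<close>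

theorem free_unitary_hom_algebra:
  assumes "unitary_hom_algebra s m a u" and f: "Vector_Spaces.linear smult s f"
    and \<alpha>: "Vector_Spaces.linear smult smult \<alpha>" and f\<alpha>: "f \<circ> \<alpha> = a \<circ> f"
  shows "twist \<alpha> \<circ> gen = gen \<circ> \<alpha>"
    and "unitary_hom_algebra_hom smult (hom_mult \<alpha>) (twist \<alpha>) unit s m a u (induced s m u f)"
    and "induced s m u f \<circ> gen = f"
    and "unitary_hom_algebra_hom smult (hom_mult \<alpha>) (twist \<alpha>) unit s m a u \<phi> \<Longrightarrow>
      \<phi> \<circ> gen = f \<Longrightarrow> \<phi> = induced s m u f"
proof -
  interpret unitary_hom_algebra s m a u by fact
  have s: "vector_space s" by unfold_locales
  let ?\<phi> = "induced s m u f"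
  note lin = induced_linear[OF s, of m u f]
  show "twist \<alpha> \<circ> gen = gen \<circ> \<alpha>" using twist_gen[OF \<alpha>] by auto
  have au: "a (u 1) = u 1" using fun_cong[OF a_unit, of 1] by simp
  have mult_aug: "?\<phi> (mult x y) = m (?\<phi> x) (?\<phi> y)"
    if xy: "Poly_Mapping.lookup x None = 0" "Poly_Mapping.lookup y None = 0" for x y
  proof (rule bilinear_eq_on_keys[OF bilinear_comp_out[OF mult_bilinear lin]
        bilinear_comp_in[OF m_bilinear lin lin]])
    fix w v assume "w \<in> Poly_Mapping.keys x" "v \<in> Poly_Mapping.keys y"
    then have "w \<noteq> None" "v \<noteq> None" using xy unfolding in_keys_iff by metis+
    then show "?\<phi> (mult (basis w) (basis v)) = m (?\<phi> (basis w)) (?\<phi> (basis v))"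
      by (auto simp: induced_basis s)
  qed
  have tw_tree: "?\<phi> (twist \<alpha> (basis (Some t))) = a (?\<phi> (basis (Some t)))" for t
  proof (induction t)
    case (Leaf g)
    then show ?case using fun_cong[OF f\<alpha>, of "basis g"] by (simp add: induced_gen[OF f] induced_basis s)
  next
    case (Node l r)
    then show ?case by (simp add: mult_aug lookup_twist_None induced_basis s a_mult)
  qed
  have tw: "?\<phi> (twist \<alpha> x) = a (?\<phi> x)" for x
  proof (rule linear_eq_on_keys[OF lin_comp[OF twist_linear lin] lin_comp[OF lin a_linear]])
    fix w
    show "?\<phi> (twist \<alpha> (basis w)) = a (?\<phi> (basis w))"
      by (cases w) (simp_all add: tw_tree induced_basis s au)
  qed
  have "?\<phi> (hom_mult \<alpha> x y) = m (?\<phi> x) (?\<phi> y)" for x y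
  proof (rule bilinear_eq_on_keys[OF bilinear_comp_out[OF hom_mult_bilinear lin]
        bilinear_comp_in[OF m_bilinear lin lin]])
    fix w v
    show "?\<phi> (hom_mult \<alpha> (basis w) (basis v)) = m (?\<phi> (basis w)) (?\<phi> (basis v))"
      by (cases w; cases v)
        (simp_all add: tw tw_tree au induced_basis s m_unit_left m_unit_right del: twist_basis)
  qed
  then show 1: "unitary_hom_algebra_hom smult (hom_mult \<alpha>) (twist \<alpha>) unit s m a u ?\<phi>"
    by (auto simp: unitary_hom_algebra_hom_def lin tw induced_unit[OF u_linear])
  show 2: "?\<phi> \<circ> gen = f" by (auto simp: induced_gen[OF f])
  show "\<phi> = ?\<phi>"
    if \<phi>: "unitary_hom_algebra_hom smult (hom_mult \<alpha>) (twist \<alpha>) unit s m a u \<phi>" "\<phi> \<circ> gen = f"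
  proof (rule free_alg_hom_unique[where m = m and s = s])
    have node: "basis (Some (Node l r)) = hom_mult \<alpha> (basis (Some l)) (basis (Some r))"
      for l r :: "'c tree"
      by simp
    show "\<phi> (basis (Some (Node l r))) = m (\<phi> (basis (Some l))) (\<phi> (basis (Some r)))" for l r
      using \<phi> unfolding node unitary_hom_algebra_hom_def by (simp del: hom_mult_basis)
  qed (use \<phi> 1 2 lin in \<open>auto simp: unitary_hom_algebra_hom_def fun_eq_iff induced_basis s\<close>)
qed


section \<open>Tensor products\<close>

text \<open>The tensor product of spaces with bases \<open>'x\<close> and \<open>'y\<close> is the space with basis \<open>'x \<times> 'y\<close>,
  see \<open>tensor_product\<close> below.\<close>

definition tens :: "('x \<Rightarrow>\<^sub>0 'k::field) \<Rightarrow> ('y \<Rightarrow>\<^sub>0 'k) \<Rightarrow> ('x \<times> 'y \<Rightarrow>\<^sub>0 'k)" where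
  "tens = bilin_ext smult (\<lambda>x y. basis (x, y))"

definition tens_mult ::
  "(('x \<Rightarrow>\<^sub>0 'k) \<Rightarrow> ('x \<Rightarrow>\<^sub>0 'k) \<Rightarrow> ('x \<Rightarrow>\<^sub>0 'k)) \<Rightarrow>
   ('x \<times> 'x \<Rightarrow>\<^sub>0 'k::field) \<Rightarrow> ('x \<times> 'x \<Rightarrow>\<^sub>0 'k) \<Rightarrow> ('x \<times> 'x \<Rightarrow>\<^sub>0 'k)" where
  "tens_mult m = bilin_ext smult (\<lambda>(x, x') (y, y').
     tens (m (basis x) (basis y)) (m (basis x') (basis y')))"

definition tens_map ::
  "(('x \<Rightarrow>\<^sub>0 'k) \<Rightarrow> ('x \<Rightarrow>\<^sub>0 'k)) \<Rightarrow> ('x \<times> 'x \<Rightarrow>\<^sub>0 'k::field) \<Rightarrow> ('x \<times> 'x \<Rightarrow>\<^sub>0 'k)" where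
  "tens_map a = lin_ext smult (\<lambda>(x, x'). tens (a (basis x)) (a (basis x')))"

definition tens_unit :: "('k \<Rightarrow> ('x \<Rightarrow>\<^sub>0 'k)) \<Rightarrow> 'k::field \<Rightarrow> ('x \<times> 'x \<Rightarrow>\<^sub>0 'k)" where
  "tens_unit u c = smult c (tens (u 1) (u 1))"

lemma tens_basis [simp]: "tens (basis x) (basis y) = basis (x, y)"
  by (simp add: tens_def vector_space_smult)

lemma tens_bilinear: "bilinear_map smult smult smult tens"
  unfolding tens_def by (rule bilinear_bilin_ext[OF vector_space_smult])

theorem tensor_product:
  fixes h :: "('x \<Rightarrow>\<^sub>0 'k::field) \<Rightarrow> ('y \<Rightarrow>\<^sub>0 'k) \<Rightarrow> 'c::ab_group_add"
  assumes "bilinear_map smult smult s h"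
  shows "\<exists>!\<phi>. Vector_Spaces.linear smult s \<phi> \<and> (\<forall>p q. \<phi> (tens p q) = h p q)"
proof (rule ex1I[where a = "lin_ext s (\<lambda>(x, y). h (basis x) (basis y))"])
  have s: "vector_space s" using assms by (auto simp: bilinear_map_def dest: linearD)
  let ?\<phi> = "lin_ext s (\<lambda>(x, y). h (basis x) (basis y))"
  note lin = linear_lin_ext[OF s, of "\<lambda>(x, y). h (basis x) (basis y)"]
  have "?\<phi> (tens p q) = h p q" for p q
    by (rule bilinear_eq_on_keys[OF bilinear_comp_out[OF tens_bilinear lin] assms]) (simp add: s)
  with lin show "Vector_Spaces.linear smult s ?\<phi> \<and> (\<forall>p q. ?\<phi> (tens p q) = h p q)" by blast
  show "\<phi> = ?\<phi>" if "Vector_Spaces.linear smult s \<phi> \<and> (\<forall>p q. \<phi> (tens p q) = h p q)" for \<phi>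
  proof (rule linear_eqI)
    fix z :: "'x \<times> 'y"
    obtain x y where z: "z = (x, y)" by (cases z)
    have "\<phi> (basis z) = \<phi> (tens (basis x) (basis y))" by (simp add: z)
    also have "\<dots> = h (basis x) (basis y)" using that by (simp del: tens_basis)
    finally show "\<phi> (basis z) = ?\<phi> (basis z)" by (simp add: z s)
  qed (use that lin in auto)
qed

lemma tens_mult_tens:
  assumes "bilinear_map smult smult smult m"
  shows "tens_mult m (tens p q) (tens p' q') = tens (m p p') (m q q')"
proof -
  note b = bilinear_bilin_ext[OF vector_space_smult]
  note B = b[of "\<lambda>(x, x') (y, y'). tens (m (basis x) (basis y)) (m (basis x') (basis y'))",
      folded tens_mult_def]
  have 1: "tens_mult m (tens (basis x) (basis y)) (tens p' q') = tens (m (basis x) p') (m (basis y) q')"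
    for x y p' q'
    by (rule bilinear_eq_on_keys[OF bilinear_comp_out[OF tens_bilinear bilinear_mapD(1)[OF B]]
          bilinear_comp_in[OF tens_bilinear bilinear_mapD(1)[OF assms] bilinear_mapD(1)[OF assms]]])
      (simp add: tens_mult_def vector_space_smult)
  show ?thesis
    by (rule bilinear_eq_on_keys[OF bilinear_comp_out[OF tens_bilinear bilinear_mapD(2)[OF B]]
          bilinear_comp_in[OF tens_bilinear bilinear_mapD(2)[OF assms] bilinear_mapD(2)[OF assms]]])
      (rule 1)
qed

lemma tens_map_tens:
  assumes "Vector_Spaces.linear smult smult a"
  shows "tens_map a (tens p q) = tens (a p) (a q)"
  unfolding tens_map_def
  by (rule bilinear_eq_on_keys[OF
        bilinear_comp_out[OF tens_bilinear linear_lin_ext[OF vector_space_smult]]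
        bilinear_comp_in[OF tens_bilinear assms assms]])
    (simp add: vector_space_smult)

lemma tens_mult_bilinear: "bilinear_map smult smult smult (tens_mult m)"
  unfolding tens_mult_def by (rule bilinear_bilin_ext[OF vector_space_smult])

lemma tens_map_linear: "Vector_Spaces.linear smult smult (tens_map a)"
  unfolding tens_map_def by (rule linear_lin_ext[OF vector_space_smult])

lemma tens_unit_linear: "Vector_Spaces.linear (*) smult (tens_unit u)"
  unfolding tens_unit_def by (rule lin_scale_left[OF vector_space_smult])

lemma tens_unit_1: "tens_unit u 1 = tens (u 1) (u 1)"
  using vector_space.vector_space_assms(4)[OF vector_space_smult] by (simp add: tens_unit_def)

lemma tens_linear_eqI:
  assumes "Vector_Spaces.linear smult s f" "Vector_Spaces.linear smult s g"
    and "\<And>x y. f (tens x y) = g (tens x y)"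
  shows "f z = g z"
proof (rule linear_eq_on_keys[OF assms(1,2)])
  fix w show "f (basis w) = g (basis w)"
    using assms(3)[of "basis (fst w)" "basis (snd w)"] by simp
qed

theorem unital_algebra_tensor_square:
  assumes "unital_algebra smult m u"
  shows "unital_algebra smult (tens_mult m) (tens_unit u)"
proof -
  interpret A: unital_algebra smult m u by fact
  note id = lin_ident[OF vector_space_smult]
  have "tens_mult m (tens_unit u 1) z = z" for z
    by (rule tens_linear_eqI[OF bilinear_mapD(1)[OF tens_mult_bilinear] id])
      (simp add: tens_unit_1 tens_mult_tens A.m_bilinear A.m_unit_left)
  moreover have "tens_mult m z (tens_unit u 1) = z" for z
    by (rule tens_linear_eqI[OF bilinear_mapD(2)[OF tens_mult_bilinear] id])
      (simp add: tens_unit_1 tens_mult_tens A.m_bilinear A.m_unit_right)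
  ultimately show ?thesis
    by (simp add: unital_algebra_def unital_algebra_axioms_def vector_space_smult
        tens_mult_bilinear tens_unit_linear)
qed

theorem unitary_hom_algebra_tensor_square:
  assumes "unitary_hom_algebra smult m a u"
  shows "unitary_hom_algebra smult (tens_mult m) (tens_map a) (tens_unit u)"
proof -
  interpret A: unitary_hom_algebra smult m a u by fact
  note [simp] = tens_unit_1 tens_mult_tens[OF A.m_bilinear] tens_map_tens[OF A.a_linear]
  have au: "a (u c) = u c" for c using fun_cong[OF A.a_unit, of c] by simp
  have "tens_mult m (tens_unit u 1) z = tens_map a z" for z
    by (rule tens_linear_eqI[OF bilinear_mapD(1)[OF tens_mult_bilinear] tens_map_linear])
      (simp add: A.m_unit_left)
  moreover have "tens_mult m z (tens_unit u 1) = tens_map a z" for z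
    by (rule tens_linear_eqI[OF bilinear_mapD(2)[OF tens_mult_bilinear] tens_map_linear])
      (simp add: A.m_unit_right)
  moreover have "tens_map a (tens_mult m z z') = tens_mult m (tens_map a z) (tens_map a z')" for z z'
  proof (rule bilinear_eq_on_keys[OF bilinear_comp_out[OF tens_mult_bilinear tens_map_linear]
        bilinear_comp_in[OF tens_mult_bilinear tens_map_linear tens_map_linear]])
    fix w w'
    show "tens_map a (tens_mult m (basis w) (basis w')) =
        tens_mult m (tens_map a (basis w)) (tens_map a (basis w'))"
      by (cases w; cases w') (simp add: A.a_mult flip: tens_basis)
  qed
  moreover have "tens_map a \<circ> tens_unit u = tens_unit u"
    by (auto simp: tens_unit_def linearD(4)[OF tens_map_linear] au)
  ultimately show ?thesis
    by (simp add: unitary_hom_algebra_def unitary_hom_algebra_axioms_def hom_algebra_def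
        hom_algebra_axioms_def vector_space_smult tens_mult_bilinear tens_map_linear
        tens_unit_linear)
qed


section \<open>Bialgebra structures and primitive elements\<close>

text \<open>The unital algebra morphisms \<open>\<Delta>\<close>, \<open>\<epsilon>\<close> on the free unital algebra, and the morphisms of
  unitary Hom-algebras \<open>\<Delta>\<^sub>\<alpha>\<close>, \<open>\<epsilon>\<close> on the free unitary Hom-algebra, induced by the prescribed values
  on generators; see \<open>comult_unique\<close>, \<open>hom_comult_unique\<close>, \<open>counit_unique\<close> and
  \<open>hom_counit_unique\<close>. The counit depends neither on the product nor on \<open>\<alpha>\<close>.\<close>

definition comult :: "('g, 'k::field) free_alg \<Rightarrow> ('g word \<times> 'g word \<Rightarrow>\<^sub>0 'k)" where
  "comult = induced smult (tens_mult mult) (tens_unit unit)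
     (\<lambda>v. tens (unit 1) (gen v) + tens (gen v) (unit 1))"

definition hom_comult ::
  "(('g \<Rightarrow>\<^sub>0 'k) \<Rightarrow> ('g \<Rightarrow>\<^sub>0 'k)) \<Rightarrow> ('g, 'k::field) free_alg \<Rightarrow> ('g word \<times> 'g word \<Rightarrow>\<^sub>0 'k)" where
  "hom_comult \<alpha> = induced smult (tens_mult (hom_mult \<alpha>)) (tens_unit unit)
     (\<lambda>v. tens (unit 1) (gen v) + tens (gen v) (unit 1))"

definition counit :: "('g, 'k::field) free_alg \<Rightarrow> 'k" where
  "counit = induced (*) (*) id (\<lambda>_. 0)"

text \<open>The element \<open>unit 1\<close> is the unit of both the free unital algebra and the free unitary
  Hom-algebra.\<close>

definition primitive ::
  "(('g, 'k::field) free_alg \<Rightarrow> ('g word \<times> 'g word \<Rightarrow>\<^sub>0 'k)) \<Rightarrow> ('g, 'k) free_alg \<Rightarrow> bool" where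
  "primitive \<Delta> p \<longleftrightarrow> \<Delta> p = tens (unit 1) p + tens p (unit 1)"

lemma prim_gen_linear:
  "Vector_Spaces.linear smult smult (\<lambda>v. tens (unit 1) (gen v) + tens (gen v) (unit 1))"
  by (intro lin_add lin_comp[OF gen_linear] bilinear_mapD[OF tens_bilinear])

lemma gen_linear_ext:
  assumes "Vector_Spaces.linear smult s \<phi>" "Vector_Spaces.linear smult s f"
  shows "\<phi> \<circ> gen = f \<longleftrightarrow> (\<forall>g. \<phi> (gen (basis g)) = f (basis g))"
proof
  assume "\<forall>g. \<phi> (gen (basis g)) = f (basis g)"
  then have "(\<lambda>v. \<phi> (gen v)) = f"
    by (intro linear_eqI[OF lin_comp[OF gen_linear assms(1)] assms(2)]) blast
  then show "\<phi> \<circ> gen = f" by (simp add: o_def)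
next
  assume "\<phi> \<circ> gen = f"
  then show "\<forall>g. \<phi> (gen (basis g)) = f (basis g)" unfolding o_def by blast
qed

theorem comult_unique:
  "\<Delta> = comult \<longleftrightarrow>
    unital_algebra_hom smult mult unit smult (tens_mult mult) (tens_unit unit) \<Delta> \<and>
    (\<forall>g. \<Delta> (gen (basis g)) = tens (unit 1) (gen (basis g)) + tens (gen (basis g)) (unit 1))"
proof -
  let ?hom = "unital_algebra_hom smult mult unit smult (tens_mult mult) (tens_unit unit)"
  let ?f = "\<lambda>v. tens (unit 1) (gen v) + tens (gen v) (unit 1)"
  note free = free_unital_algebra[OF unital_algebra_tensor_square[OF unital_algebra_free_alg]
      prim_gen_linear, folded comult_def]
  show ?thesis
  proof
    assume D: "\<Delta> = comult"
    show "?hom \<Delta> \<and> (\<forall>g. \<Delta> (gen (basis g)) = ?f (basis g))"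
      unfolding D
      using free(1) gen_linear_ext[THEN iffD1, OF free(1)[unfolded unital_algebra_hom_def, THEN conjunct1]
          prim_gen_linear free(2)]
      by (rule conjI)
  next
    assume D: "?hom \<Delta> \<and> (\<forall>g. \<Delta> (gen (basis g)) = ?f (basis g))"
    then have hom: "?hom \<Delta>" by (rule conjunct1)
    show "\<Delta> = comult"
      by (rule free(3)[OF hom gen_linear_ext[THEN iffD2, OF hom[unfolded unital_algebra_hom_def, THEN conjunct1]
            prim_gen_linear D[THEN conjunct2]]])
  qed
qed

theorem hom_comult_unique:
  assumes \<alpha>: "Vector_Spaces.linear smult smult \<alpha>"
  shows "\<Delta> = hom_comult \<alpha> \<longleftrightarrow>
    unitary_hom_algebra_hom smult (hom_mult \<alpha>) (twist \<alpha>) unit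
      smult (tens_mult (hom_mult \<alpha>)) (tens_map (twist \<alpha>)) (tens_unit unit) \<Delta> \<and>
    (\<forall>g. \<Delta> (gen (basis g)) = tens (unit 1) (gen (basis g)) + tens (gen (basis g)) (unit 1))"
proof -
  let ?f = "\<lambda>v. tens (unit 1) (gen v) + tens (gen v) (unit 1)"
  have "?f \<circ> \<alpha> = tens_map (twist \<alpha>) \<circ> ?f"
    by (auto simp: linearD(3)[OF tens_map_linear] tens_map_tens[OF twist_linear] twist_unit
        twist_gen[OF \<alpha>])
  note free = free_unitary_hom_algebra(2-4)[OF
      unitary_hom_algebra_tensor_square[OF unitary_hom_algebra_free_alg]
      prim_gen_linear \<alpha> this, folded hom_comult_def]
  let ?hom = "unitary_hom_algebra_hom smult (hom_mult \<alpha>) (twist \<alpha>) unit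
      smult (tens_mult (hom_mult \<alpha>)) (tens_map (twist \<alpha>)) (tens_unit unit)"
  show ?thesis
  proof
    assume D: "\<Delta> = hom_comult \<alpha>"
    show "?hom \<Delta> \<and> (\<forall>g. \<Delta> (gen (basis g)) = ?f (basis g))"
      unfolding D
      using free(1) gen_linear_ext[THEN iffD1, OF free(1)[unfolded unitary_hom_algebra_hom_def, THEN conjunct1]
          prim_gen_linear free(2)]
      by (rule conjI)
  next
    assume D: "?hom \<Delta> \<and> (\<forall>g. \<Delta> (gen (basis g)) = ?f (basis g))"
    then have hom: "?hom \<Delta>" by (rule conjunct1)
    show "\<Delta> = hom_comult \<alpha>"
      by (rule free(3)[OF hom gen_linear_ext[THEN iffD2, OF hom[unfolded unitary_hom_algebra_hom_def, THEN conjunct1]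
            prim_gen_linear D[THEN conjunct2]]])
  qed
qed

lemma unital_algebra_field: "unital_algebra (*) (*) (id :: 'k::field \<Rightarrow> 'k)"
  by (simp add: unital_algebra_def unital_algebra_axioms_def vector_space_field bilinear_field
      lin_ident id_def)

lemma unitary_hom_algebra_field: "unitary_hom_algebra (*) (*) id (id :: 'k::field \<Rightarrow> 'k)"
  by (simp add: unitary_hom_algebra_def unitary_hom_algebra_axioms_def hom_algebra_def
      hom_algebra_axioms_def vector_space_field bilinear_field lin_ident id_def o_def)

theorem counit_unique:
  "e = counit \<longleftrightarrow>
    unital_algebra_hom smult mult unit (*) (*) id e \<and> (\<forall>g. e (gen (basis g)) = 0)"
proof -
  let ?hom = "unital_algebra_hom smult mult unit (*) (*) id"
  let ?f = "\<lambda>_. 0"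
  note free = free_unital_algebra[OF unital_algebra_field
      lin_zero[OF vector_space_smult vector_space_field], folded counit_def]
  show ?thesis
  proof
    assume D: "e = counit"
    show "?hom e \<and> (\<forall>g. e (gen (basis g)) = ?f (basis g))"
      unfolding D
      using free(1) gen_linear_ext[THEN iffD1, OF free(1)[unfolded unital_algebra_hom_def, THEN conjunct1]
          lin_zero[OF vector_space_smult vector_space_field] free(2)]
      by (rule conjI)
  next
    assume D: "?hom e \<and> (\<forall>g. e (gen (basis g)) = ?f (basis g))"
    then have hom: "?hom e" by (rule conjunct1)
    show "e = counit"
      by (rule free(3)[OF hom gen_linear_ext[THEN iffD2, OF hom[unfolded unital_algebra_hom_def, THEN conjunct1]
            lin_zero[OF vector_space_smult vector_space_field] D[THEN conjunct2]]])
  qed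
qed

theorem hom_counit_unique:
  assumes \<alpha>: "Vector_Spaces.linear smult smult \<alpha>"
  shows "e = counit \<longleftrightarrow>
    unitary_hom_algebra_hom smult (hom_mult \<alpha>) (twist \<alpha>) unit (*) (*) id id e \<and>
    (\<forall>g. e (gen (basis g)) = 0)"
proof -
  have "(\<lambda>_. 0) \<circ> \<alpha> = id \<circ> (\<lambda>_. 0)" by auto
  note free = free_unitary_hom_algebra(2-4)[OF unitary_hom_algebra_field
      lin_zero[OF vector_space_smult vector_space_field] \<alpha> this, folded counit_def]
  let ?hom = "unitary_hom_algebra_hom smult (hom_mult \<alpha>) (twist \<alpha>) unit (*) (*) id id"
  let ?f = "\<lambda>_. 0"
  show ?thesis
  proof
    assume D: "e = counit"
    show "?hom e \<and> (\<forall>g. e (gen (basis g)) = ?f (basis g))"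
      unfolding D
      using free(1) gen_linear_ext[THEN iffD1, OF free(1)[unfolded unitary_hom_algebra_hom_def, THEN conjunct1]
          lin_zero[OF vector_space_smult vector_space_field] free(2)]
      by (rule conjI)
  next
    assume D: "?hom e \<and> (\<forall>g. e (gen (basis g)) = ?f (basis g))"
    then have hom: "?hom e" by (rule conjunct1)
    show "e = counit"
      by (rule free(3)[OF hom gen_linear_ext[THEN iffD2, OF hom[unfolded unitary_hom_algebra_hom_def, THEN conjunct1]
            lin_zero[OF vector_space_smult vector_space_field] D[THEN conjunct2]]])
  qed
qed


section \<open>The Hom-type element of a nonassociative polynomial\<close>

text \<open>A vertex of a tree is encoded by the path leading to it from the root, \<open>False\<close> for left and
  \<open>True\<close> for right; a leaf is a descendant of a vertex iff the path of the vertex is a prefix of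
  the path of the leaf.\<close>

primrec internal_nodes :: "'a tree \<Rightarrow> bool list set" where
  "internal_nodes (Leaf a) = {}"
| "internal_nodes (Node l r) =
     {[]} \<union> (#) False ` internal_nodes l \<union> (#) True ` internal_nodes r"

primrec relabel :: "(bool list \<Rightarrow> 'a \<Rightarrow> 'b) \<Rightarrow> 'a tree \<Rightarrow> 'b tree" where
  "relabel f (Leaf a) = Leaf (f [] a)"
| "relabel f (Node l r) = Node (relabel (\<lambda>q. f (False # q)) l) (relabel (\<lambda>q. f (True # q)) r)"

definition hom_type_tree ::
  "(('g \<Rightarrow>\<^sub>0 'k) \<Rightarrow> ('g \<Rightarrow>\<^sub>0 'k)) \<Rightarrow> 'g tree \<Rightarrow> ('g, 'k::field) free_alg tree" where
  "hom_type_tree \<alpha> t =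
     relabel (\<lambda>q g. (twist \<alpha> ^^ card {N \<in> internal_nodes t. \<not> prefix N q}) (gen (basis g))) t"

text \<open>The empty word is sent to the unit; primitive elements do not involve it.\<close>

definition hom_type ::
  "(('g \<Rightarrow>\<^sub>0 'k) \<Rightarrow> ('g \<Rightarrow>\<^sub>0 'k)) \<Rightarrow> ('g, 'k::field) free_alg \<Rightarrow> ('g, 'k) free_alg" where
  "hom_type \<alpha> = lin_ext smult (\<lambda>w. case w of
      None \<Rightarrow> unit 1
    | Some t \<Rightarrow> eval_tree (hom_mult \<alpha>) (hom_type_tree \<alpha> t))"

lemma lin_diff:
  "Vector_Spaces.linear smult smult f \<Longrightarrow> f (p - q) = f p - f q"
  by (metis add_diff_cancel_right' diff_add_cancel linearD(3))

text \<open>The Hom-type element of \<open>(xy)z - x(yz)\<close> is \<open>(xy)\<alpha>(z) - \<alpha>(x)(yz)\<close>.\<close>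

lemma hom_type_associator:
  fixes \<alpha> :: "('g \<Rightarrow>\<^sub>0 'k::field) \<Rightarrow> ('g \<Rightarrow>\<^sub>0 'k)" and x y z :: 'g
  defines "X \<equiv> gen (basis x)" and "Y \<equiv> gen (basis y)" and "Z \<equiv> gen (basis z)"
  shows "hom_type \<alpha> (mult (mult X Y) Z - mult X (mult Y Z)) =
    hom_mult \<alpha> (hom_mult \<alpha> X Y) (twist \<alpha> Z) - hom_mult \<alpha> (twist \<alpha> X) (hom_mult \<alpha> Y Z)"
proof -
  have lin: "Vector_Spaces.linear smult smult (hom_type \<alpha>)"
    unfolding hom_type_def by (rule linear_lin_ext[OF vector_space_smult])
  have [simp]:
    "{N. (N = [False] \<or> N = []) \<and> \<not> prefix N [False, b]} = {}"
    "{N. (N = [False] \<or> N = []) \<and> \<not> prefix N [True]} = {[False]}"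
    "{N. (N = [True] \<or> N = []) \<and> \<not> prefix N [True, b]} = {}"
    "{N. (N = [True] \<or> N = []) \<and> \<not> prefix N [False]} = {[True]}" for b
    by auto
  have "hom_type \<alpha> (mult (mult X Y) Z) = hom_mult \<alpha> (hom_mult \<alpha> X Y) (twist \<alpha> Z)"
    by (simp add: X_def Y_def Z_def hom_type_def vector_space_smult hom_type_tree_def del: twist_basis)
  moreover have "hom_type \<alpha> (mult X (mult Y Z)) = hom_mult \<alpha> (twist \<alpha> X) (hom_mult \<alpha> Y Z)"
    by (simp add: X_def Y_def Z_def hom_type_def vector_space_smult hom_type_tree_def del: twist_basis)
  ultimately show ?thesis by (simp add: lin_diff[OF lin])
qed

end

theory Submission
  imports Defs
begin

text \<open>In a unitary Hom-algebra a product with the unit is an application of the twisting map. Let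
  \<open>t\<close> be a word with \<open>n\<close> leaves. A leaf at depth \<open>d\<close> has \<open>d\<close> of the \<open>n - 1\<close> internal nodes above
  it, so it carries \<open>\<alpha>\<^sup>n\<^sup>-\<^sup>1\<^sup>-\<^sup>d\<close> in \<open>t\<^sup>\<alpha>\<close>. The coproduct of \<open>t\<close> is the sum of \<open>t\<^sub>S \<otimes> t\<^sub>T\<close> over all
  splittings of the leaves into two sets \<open>S\<close>, \<open>T\<close>, where \<open>t\<^sub>S\<close> is what remains of \<open>t\<close> when the leaves
  outside \<open>S\<close> are replaced by the unit. In the coproduct of \<open>t\<^sup>\<alpha>\<close> the same splittings occur, but
  each node of \<open>t\<close> that disappears above a leaf of \<open>t\<^sub>S\<close> applies \<open>\<alpha>\<close> once to this leaf. A leaf at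
  depth \<open>d'\<close> in \<open>t\<^sub>S\<close> therefore ends up with \<open>\<alpha>\<^sup>n\<^sup>-\<^sup>1\<^sup>-\<^sup>d\<^sup>'\<close>, whatever its depth in \<open>t\<close> was; since it
  carries \<open>\<alpha>\<close> to the power \<open>card S - 1 - d'\<close> in \<open>(t\<^sub>S)\<^sup>\<alpha>\<close>, the left tensor factor is
  \<open>(t\<^sub>S)\<^sup>\<alpha>\<close> twisted \<open>card T\<close> times, and symmetrically on the right.

  Hence \<open>\<Delta>\<^sub>\<alpha> (p\<^sup>\<alpha>) = \<Psi> (\<Delta> p)\<close> for every \<open>p\<close>, where the linear map \<open>\<Psi>\<close> (\<open>hom_type_tens\<close>) sends a
  tensor product of words \<open>w \<otimes> v\<close> to the tensor product of \<open>w\<^sup>\<alpha>\<close> twisted \<open>degree v\<close> times and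
  \<open>v\<^sup>\<alpha>\<close> twisted \<open>degree w\<close> times; this is \<open>hom_comult_hom_type\<close>. As the empty word has degree \<open>0\<close>
  and is fixed by the twisting map, \<open>\<Psi>\<close> sends \<open>1 \<otimes> p + p \<otimes> 1\<close> to
  \<open>1 \<otimes> p\<^sup>\<alpha> + p\<^sup>\<alpha> \<otimes> 1\<close>.

  The identity is proved by induction on the tree. Both maps \<open>p \<mapsto> p\<^sup>\<alpha>\<close> and \<open>\<Psi>\<close> are
  multiplicative up to powers of the twisting map that depend on the degrees
  (\<open>twist_hom_type_word_mult\<close>, \<open>hom_type_tens_mult\<close>), and the coproduct preserves degrees
  (\<open>comult_homogeneous\<close>).\<close>

section \<open>Powers of the twisting map\<close>

lemma twist_funpow_linear: "Vector_Spaces.linear smult smult (twist \<alpha> ^^ n)"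
proof (induction n)
  case 0
  then show ?case using lin_ident[OF vector_space_smult] by (simp add: id_def)
next
  case (Suc n)
  then show ?case using lin_comp[OF Suc twist_linear] by (simp add: o_def)
qed

lemma twist_funpow_unit: "(twist \<alpha> ^^ n) (unit c) = unit c"
  by (induction n) (simp_all add: twist_unit)

lemma twist_hom_mult: "twist \<alpha> (hom_mult \<alpha> x y) = hom_mult \<alpha> (twist \<alpha> x) (twist \<alpha> y)"
proof -
  interpret unitary_hom_algebra smult "hom_mult \<alpha>" "twist \<alpha>" unit
    by (rule unitary_hom_algebra_free_alg)
  show ?thesis by (rule a_mult)
qed

lemma twist_funpow_hom_mult:
  "(twist \<alpha> ^^ n) (hom_mult \<alpha> x y) = hom_mult \<alpha> ((twist \<alpha> ^^ n) x) ((twist \<alpha> ^^ n) y)"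
  by (induction n) (simp_all add: twist_hom_mult)

lemma twist_funpow_add: "(twist \<alpha> ^^ m) ((twist \<alpha> ^^ n) x) = (twist \<alpha> ^^ (m + n)) x"
  by (simp add: funpow_add)


section \<open>The Hom-type element of a product of words\<close>

lemma relabel_comp: "relabel (\<lambda>q a. h (f q a)) t = map_tree h (relabel f t)"
  by (induction t arbitrary: f) simp_all

lemma eval_tree_map_tree:
  assumes "\<And>x y. h (m x y) = m (h x) (h y)"
  shows "eval_tree m (map_tree h t) = h (eval_tree m t)"
  by (induction t) (simp_all add: assms)

lemma finite_internal_nodes: "finite (internal_nodes t)"
  by (induction t) simp_all

definition node_count :: "'g tree \<Rightarrow> nat" where
  "node_count t = card (internal_nodes t)"

lemma node_count_simps [simp]:
  "node_count (Leaf g) = 0"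
  "node_count (Node l r) = Suc (node_count l + node_count r)"
proof -
  have "node_count (Node l r) =
      Suc (card ((#) False ` internal_nodes l \<union> (#) True ` internal_nodes r))"
    by (simp add: node_count_def finite_internal_nodes card_insert_if image_iff)
  also have "\<dots> = Suc (card ((#) False ` internal_nodes l) + card ((#) True ` internal_nodes r))"
    by (subst card_Un_disjoint) (auto simp: finite_internal_nodes)
  finally show "node_count (Node l r) = Suc (node_count l + node_count r)"
    by (simp add: node_count_def card_image)
qed (simp add: node_count_def)

text \<open>No node of one subtree lies above a leaf of the other, while the root lies above every leaf.
  So grafting two trees adds to the exponent at each leaf the number of nodes of the sibling
  subtree; this gives the recursion \<open>hom_type_Node\<close>.\<close>

lemma card_not_above_left:
  "card {N \<in> internal_nodes (Node l r). \<not> prefix N (False # q)} =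
     node_count r + card {N \<in> internal_nodes l. \<not> prefix N q}"
proof -
  have "{N \<in> internal_nodes (Node l r). \<not> prefix N (False # q)} =
      (#) True ` internal_nodes r \<union> (#) False ` {N \<in> internal_nodes l. \<not> prefix N q}"
    by auto
  then show ?thesis
    by (simp, subst card_Un_disjoint)
      (auto simp: finite_internal_nodes card_image node_count_def)
qed

lemma card_not_above_right:
  "card {N \<in> internal_nodes (Node l r). \<not> prefix N (True # q)} =
     node_count l + card {N \<in> internal_nodes r. \<not> prefix N q}"
proof -
  have "{N \<in> internal_nodes (Node l r). \<not> prefix N (True # q)} =
      (#) False ` internal_nodes l \<union> (#) True ` {N \<in> internal_nodes r. \<not> prefix N q}"
    by auto
  then show ?thesis
    by (simp, subst card_Un_disjoint)
      (auto simp: finite_internal_nodes card_image node_count_def)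
qed

lemma hom_type_tree_Node:
  "hom_type_tree \<alpha> (Node l r) =
     Node (map_tree (twist \<alpha> ^^ node_count r) (hom_type_tree \<alpha> l))
          (map_tree (twist \<alpha> ^^ node_count l) (hom_type_tree \<alpha> r))"
  unfolding hom_type_tree_def relabel.simps(2) card_not_above_left card_not_above_right
  by (simp add: funpow_add relabel_comp[symmetric])

lemma hom_type_linear: "Vector_Spaces.linear smult smult (hom_type \<alpha>)"
  unfolding hom_type_def by (rule linear_lin_ext[OF vector_space_smult])

lemma hom_type_None: "hom_type \<alpha> (basis None) = unit 1"
  by (simp add: hom_type_def vector_space_smult)

lemma hom_type_Leaf: "hom_type \<alpha> (basis (Some (Leaf g))) = gen (basis g)"
  by (simp add: hom_type_def vector_space_smult hom_type_tree_def)

lemma hom_type_Node: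
  "hom_type \<alpha> (basis (Some (Node l r))) =
     hom_mult \<alpha> ((twist \<alpha> ^^ node_count r) (hom_type \<alpha> (basis (Some l))))
                ((twist \<alpha> ^^ node_count l) (hom_type \<alpha> (basis (Some r))))"
  by (simp add: hom_type_def vector_space_smult hom_type_tree_Node
      eval_tree_map_tree[where m = "hom_mult \<alpha>", OF twist_funpow_hom_mult])

text \<open>A binary tree has one more leaf than internal nodes, so this is the number of letters.\<close>

definition degree :: "'g word \<Rightarrow> nat" where
  "degree w = (case w of None \<Rightarrow> 0 | Some t \<Rightarrow> Suc (node_count t))"

lemma degree_simps [simp]: "degree None = 0" "degree (Some t) = Suc (node_count t)"
  by (simp_all add: degree_def)

lemma degree_word_mult: "degree (word_mult x y) = degree x + degree y"
  by (cases x; cases y) simp_all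

text \<open>For nonempty words this is the recursion for Hom-type elements. The exponents \<open>i\<close>, \<open>j\<close>, which
  will be the degrees of the complementary factors of a coproduct, leave room for the case of an
  empty factor: there the product with the unit contributes the twist by which the two sides would
  differ otherwise. In the application \<open>m\<close> and \<open>n\<close> are the numbers of internal nodes of the two trees
  that are multiplied, whose leaves are distributed over the two tensor factors.\<close>

lemma twist_hom_type_word_mult:
  assumes "degree x + i = Suc m" "degree y + j = Suc n"
  shows "(twist \<alpha> ^^ (i + j)) (hom_type \<alpha> (basis (word_mult x y))) =
    hom_mult \<alpha> ((twist \<alpha> ^^ (n + i)) (hom_type \<alpha> (basis x)))
               ((twist \<alpha> ^^ (m + j)) (hom_type \<alpha> (basis y)))"
proof (cases x)
  case None
  then have "i + j = Suc (m + j)" using assms by simp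
  then show ?thesis
    by (simp add: None hom_type_None twist_funpow_unit twist_unit hom_mult_unit_left)
next
  case x: (Some l)
  show ?thesis
  proof (cases y)
    case None
    then have "i + j = Suc (n + i)" using assms by simp
    then show ?thesis
      by (simp add: None x hom_type_None twist_funpow_unit twist_unit hom_mult_unit_right add.commute)
  next
    case (Some r)
    then have "n = node_count r + j" "m = node_count l + i" using assms x by simp_all
    then show ?thesis
      by (simp add: Some x hom_type_Node twist_funpow_hom_mult twist_funpow_add ac_simps)
  qed
qed


section \<open>Hom-type elements of the tensor square\<close>

definition hom_type_tens ::
  "(('g \<Rightarrow>\<^sub>0 'k) \<Rightarrow> ('g \<Rightarrow>\<^sub>0 'k)) \<Rightarrow> ('g word \<times> 'g word \<Rightarrow>\<^sub>0 'k::field) \<Rightarrow>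
     ('g word \<times> 'g word \<Rightarrow>\<^sub>0 'k)" where
  "hom_type_tens \<alpha> = lin_ext smult (\<lambda>(w, v).
     tens ((twist \<alpha> ^^ degree v) (hom_type \<alpha> (basis w)))
          ((twist \<alpha> ^^ degree w) (hom_type \<alpha> (basis v))))"

lemma hom_type_tens_linear: "Vector_Spaces.linear smult smult (hom_type_tens \<alpha>)"
  unfolding hom_type_tens_def by (rule linear_lin_ext[OF vector_space_smult])

lemma hom_type_tens_basis:
  "hom_type_tens \<alpha> (basis (w, v)) =
     tens ((twist \<alpha> ^^ degree v) (hom_type \<alpha> (basis w)))
          ((twist \<alpha> ^^ degree w) (hom_type \<alpha> (basis v)))"
  by (simp add: hom_type_tens_def vector_space_smult)

lemma hom_type_tens_unit_left: "hom_type_tens \<alpha> (tens (unit 1) p) = tens (unit 1) (hom_type \<alpha> p)"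
  by (rule linear_eq_on_keys[OF lin_comp[OF bilinear_mapD(1)[OF tens_bilinear] hom_type_tens_linear]
        lin_comp[OF hom_type_linear bilinear_mapD(1)[OF tens_bilinear]]])
    (simp add: unit_1 hom_type_tens_basis hom_type_None twist_funpow_unit[where c = 1, unfolded unit_1])

lemma hom_type_tens_unit_right: "hom_type_tens \<alpha> (tens p (unit 1)) = tens (hom_type \<alpha> p) (unit 1)"
  by (rule linear_eq_on_keys[OF lin_comp[OF bilinear_mapD(2)[OF tens_bilinear] hom_type_tens_linear]
        lin_comp[OF hom_type_linear bilinear_mapD(2)[OF tens_bilinear]]])
    (simp add: unit_1 hom_type_tens_basis hom_type_None twist_funpow_unit[where c = 1, unfolded unit_1])

definition homogeneous :: "nat \<Rightarrow> ('g word \<times> 'g word \<Rightarrow>\<^sub>0 'k::zero) \<Rightarrow> bool" where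
  "homogeneous n z \<longleftrightarrow> (\<forall>(w, v) \<in> Poly_Mapping.keys z. degree w + degree v = n)"

lemma homogeneous_add: "homogeneous n y \<Longrightarrow> homogeneous n z \<Longrightarrow> homogeneous n (y + z)"
  unfolding homogeneous_def using Poly_Mapping.keys_add[of y z] by blast

lemma keys_basis: "Poly_Mapping.keys (basis x :: _ \<Rightarrow>\<^sub>0 'k::field) = {x}"
  by (simp add: basis_def)

lemma keys_lin_ext:
  assumes "z \<in> Poly_Mapping.keys (lin_ext smult f p)"
  shows "\<exists>x \<in> Poly_Mapping.keys p. z \<in> Poly_Mapping.keys (f x)"
proof (rule ccontr)
  assume "\<not> ?thesis"
  then have "Poly_Mapping.lookup (lin_ext smult f p) z = 0"
    by (simp add: lin_ext_def lookup_sum in_keys_iff)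
  with assms show False by (simp add: in_keys_iff)
qed

lemma keys_bilin_ext:
  "z \<in> Poly_Mapping.keys (bilin_ext smult f p q) \<Longrightarrow>
     \<exists>x \<in> Poly_Mapping.keys p. \<exists>y \<in> Poly_Mapping.keys q. z \<in> Poly_Mapping.keys (f x y)"
  unfolding bilin_ext_def by (meson keys_lin_ext)

lemma homogeneous_tens_mult:
  assumes "homogeneous m y" "homogeneous n z"
  shows "homogeneous (m + n) (tens_mult mult y z)"
  unfolding homogeneous_def
proof safe
  fix w v assume "(w, v) \<in> Poly_Mapping.keys (tens_mult mult y z)"
  from keys_bilin_ext[OF this[unfolded tens_mult_def]]
  obtain a b c d where "(a, b) \<in> Poly_Mapping.keys y" "(c, d) \<in> Poly_Mapping.keys z"
    "w = word_mult a c" "v = word_mult b d"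
    by (force simp: keys_basis)
  with assms show "degree w + degree v = m + n"
    by (fastforce simp: homogeneous_def degree_word_mult)
qed

lemma tens_mult_mult_basis:
  "tens_mult mult (basis (a, b)) (basis (c, d)) = basis (word_mult a c, word_mult b d)"
  by (simp add: tens_mult_def vector_space_smult)

text \<open>In each tensor factor this is \<open>twist_hom_type_word_mult\<close>. It is applicable because
  homogeneity determines the degree of a word from that of the complementary one, so that a single
  power of the twisting map serves for all terms of \<open>y\<close>, and one for all terms of \<open>z\<close>.\<close>

lemma hom_type_tens_mult:
  assumes "homogeneous (Suc m) y" "homogeneous (Suc n) z"
  shows "hom_type_tens \<alpha> (tens_mult mult y z) =
    tens_mult (hom_mult \<alpha>) (tens_map (twist \<alpha> ^^ n) (hom_type_tens \<alpha> y))
                           (tens_map (twist \<alpha> ^^ m) (hom_type_tens \<alpha> z))"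
proof (rule bilinear_eq_on_keys[OF bilinear_comp_out[OF tens_mult_bilinear hom_type_tens_linear]
      bilinear_comp_in[OF tens_mult_bilinear lin_comp[OF hom_type_tens_linear tens_map_linear]
        lin_comp[OF hom_type_tens_linear tens_map_linear]]])
  fix s t assume st: "s \<in> Poly_Mapping.keys y" "t \<in> Poly_Mapping.keys z"
  obtain a b c d where s: "s = (a, b)" and t: "t = (c, d)" by (cases s; cases t)
  have ab: "degree a + degree b = Suc m" and cd: "degree c + degree d = Suc n"
    using assms st by (auto simp: homogeneous_def s t)
  from ab cd have ba: "degree b + degree a = Suc m" and dc: "degree d + degree c = Suc n"
    by simp_all
  show "hom_type_tens \<alpha> (tens_mult mult (basis s) (basis t)) =
      tens_mult (hom_mult \<alpha>) (tens_map (twist \<alpha> ^^ n) (hom_type_tens \<alpha> (basis s)))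
                             (tens_map (twist \<alpha> ^^ m) (hom_type_tens \<alpha> (basis t)))"
    by (simp del: tens_basis add: s t tens_mult_mult_basis hom_type_tens_basis tens_map_tens[OF twist_funpow_linear]
        tens_mult_tens[OF hom_mult_bilinear] degree_word_mult twist_funpow_add
        twist_hom_type_word_mult[OF ab cd] twist_hom_type_word_mult[OF ba dc])
qed


section \<open>The coproduct of a Hom-type element\<close>

lemma comult_linear: "Vector_Spaces.linear smult smult comult"
  unfolding comult_def by (rule induced_linear[OF vector_space_smult])

lemma comult_basis:
  "comult (basis None) = tens (unit 1) (unit 1)"
  "comult (basis (Some (Leaf g))) =
     tens (unit 1) (gen (basis g)) + tens (gen (basis g)) (unit 1)"
  "comult (basis (Some (Node l r))) =
     tens_mult mult (comult (basis (Some l))) (comult (basis (Some r)))"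
  by (simp_all add: comult_def induced_basis vector_space_smult tens_unit_1)

lemma comult_homogeneous: "homogeneous (Suc (node_count t)) (comult (basis (Some t)))"
proof (induction t)
  case (Leaf g)
  show ?case
    unfolding comult_basis
    by (intro homogeneous_add) (simp_all add: homogeneous_def unit_1 keys_basis)
next
  case (Node l r)
  from homogeneous_tens_mult[OF this] show ?case by (simp add: comult_basis)
qed

lemma hom_comult_hom:
  assumes "Vector_Spaces.linear smult smult \<alpha>"
  shows "hom_comult \<alpha> (hom_mult \<alpha> x y) =
      tens_mult (hom_mult \<alpha>) (hom_comult \<alpha> x) (hom_comult \<alpha> y)"
    and "hom_comult \<alpha> (twist \<alpha> x) = tens_map (twist \<alpha>) (hom_comult \<alpha> x)"
    and "hom_comult \<alpha> (unit 1) = tens (unit 1) (unit 1)"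
    and "hom_comult \<alpha> (gen (basis g)) =
      tens (unit 1) (gen (basis g)) + tens (gen (basis g)) (unit 1)"
    and "Vector_Spaces.linear smult smult (hom_comult \<alpha>)"
  using hom_comult_unique[OF assms, THEN iffD1, OF refl]
  by (auto simp: unitary_hom_algebra_hom_def fun_eq_iff tens_unit_1)

lemma tens_map_comp:
  assumes "Vector_Spaces.linear smult smult f" "Vector_Spaces.linear smult smult g"
  shows "tens_map g (tens_map f z) = tens_map (\<lambda>x. g (f x)) z"
  by (rule tens_linear_eqI[OF lin_comp[OF tens_map_linear tens_map_linear] tens_map_linear])
    (simp add: tens_map_tens assms lin_comp[OF assms])

lemma tens_map_ident: "tens_map (\<lambda>x. x) z = z"
  by (rule tens_linear_eqI[OF tens_map_linear lin_ident[OF vector_space_smult]])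
    (simp add: tens_map_tens lin_ident vector_space_smult)

lemma hom_comult_twist_funpow:
  assumes "Vector_Spaces.linear smult smult \<alpha>"
  shows "hom_comult \<alpha> ((twist \<alpha> ^^ n) x) = tens_map (twist \<alpha> ^^ n) (hom_comult \<alpha> x)"
proof (induction n)
  case 0
  then show ?case by (simp add: tens_map_ident id_def)
next
  case (Suc n)
  then show ?case
    by (simp add: hom_comult_hom(2)[OF assms] tens_map_comp twist_funpow_linear twist_linear o_def)
qed

lemma hom_comult_hom_type_tree:
  assumes "Vector_Spaces.linear smult smult \<alpha>"
  shows "hom_comult \<alpha> (hom_type \<alpha> (basis (Some t))) = hom_type_tens \<alpha> (comult (basis (Some t)))"
proof (induction t)
  case (Leaf g)
  show ?case
    by (simp only: hom_type_Leaf hom_type_Leaf[folded gen_basis] comult_basis hom_comult_hom(4)[OF assms]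
        linearD(3)[OF hom_type_tens_linear] hom_type_tens_unit_left hom_type_tens_unit_right)
next
  case (Node l r)
  show ?case
    by (simp only: hom_type_Node comult_basis hom_comult_hom(1)[OF assms]
        hom_comult_twist_funpow[OF assms] Node
        hom_type_tens_mult[OF comult_homogeneous comult_homogeneous])
qed

theorem hom_comult_hom_type:
  assumes "Vector_Spaces.linear smult smult \<alpha>"
  shows "hom_comult \<alpha> (hom_type \<alpha> p) = hom_type_tens \<alpha> (comult p)"
proof (rule linear_eq_on_keys[OF lin_comp[OF hom_type_linear hom_comult_hom(5)[OF assms]]
      lin_comp[OF comult_linear hom_type_tens_linear]])
  fix w
  show "hom_comult \<alpha> (hom_type \<alpha> (basis w)) = hom_type_tens \<alpha> (comult (basis w))"
  proof (cases w)
    case None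
    have "hom_type \<alpha> (unit 1) = unit 1" by (simp add: unit_1 hom_type_None)
    with None show ?thesis
      by (simp only: hom_type_None comult_basis hom_comult_hom(3)[OF assms] hom_type_tens_unit_left)
  qed (simp add: hom_comult_hom_type_tree[OF assms])
qed

theorem theorem3p12:
  fixes p :: "('g, 'k::field_char_0) free_alg"
    and \<alpha> :: "('g \<Rightarrow>\<^sub>0 'k) \<Rightarrow> ('g \<Rightarrow>\<^sub>0 'k)"
  assumes "primitive comult p"
    and "Vector_Spaces.linear smult smult \<alpha>"
  shows "primitive (hom_comult \<alpha>) (hom_type \<alpha> p)"
  using assms(1)
  by (simp add: primitive_def hom_comult_hom_type[OF assms(2)] linearD(3)[OF hom_type_tens_linear]
      hom_type_tens_unit_left hom_type_tens_unit_right)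

end
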